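(* Let $\alpha\in\mathbb R$ with $|\alpha|<1$. Consider the exclusion process on $\Sigma_N=\{0,1\}^{\Lambda_N}$ with generator $$\mathcal L_N f(\eta)=\sum_{(x,y)\in E_N}c_{x,y}(\eta)\,[f(\eta^{x,y})-f(\eta)],\qquad c_{x,y}(\eta)=\eta(x)(1-\eta(y))+\eta(x)\left[\tau_{\mathfrak f^+(x,y)}g(\eta)-\tau_{\mathfrak f^-(x,y)}g(\eta)\right],$$ with $g$ the local function (depending on $\alpha$) given in the context. Then the Bernoulli product measures $\nu_\rho$ on $\Sigma_N$ with parameter $\rho\in[0,1]$ are invariant but not reversible (unless $\alpha=0$) for this process.
   Context: Lattice: $\Lambda_N:=\frac1N(\mathbb Z^2/N\mathbb Z^2)$ is the two-dimensional discrete torus with mesh $1/N$; $e^{(1)}=(1/N,0)$, $e^{(2)}=(0,1/N)$; $E_N$ is the set of ordered pairs $(x,y)$ of nearest-neighbour sites of $\Lambda_N$ (i.e. $y=x\pm e^{(i)}$). An unoriented face is a set $\mathfrak f=\{x,x+e^{(1)},x+e^{(1)}+e^{(2)},x+e^{(2)}\}$; its anticlockwise orientation is the cycle $(x,x+e^{(1)},x+e^{(1)}+e^{(2)},x+e^{(2)},x)$ and its clockwise orientation is the reversed cycle. For $(x,y)\in E_N$, $\mathfrak f^+(x,y)$ is the face whose anticlockwise cycle traverses the edge from $x$ to $y$, and $\mathfrak f^-(x,y)$ is the face whose clockwise cycle traverses the edge from $x$ to $y$. Configurations: $\eta(x)\in\{0,1\}$ is the occupation number of $x$; $\eta^{x,y}$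 is $\eta$ with the values at $x$ and $y$ exchanged. Translations: $[\tau_x\eta](z)=\eta(z-x)$ and $[\tau_x h](\eta)=h(\tau_{-x}\eta)$ for functions $h$ on $\Sigma_N$; for the face $\mathfrak f=\{x,x+e^{(1)},x+e^{(1)}+e^{(2)},x+e^{(2)}\}$ one sets $\tau_{\mathfrak f}:=\tau_x$. The function $g:\Sigma_N\to\mathbb R$: $g(\eta)=\alpha$ if $\eta(0)=\eta(e^{(1)}+e^{(2)})=1$ and $\eta(e^{(1)})=\eta(e^{(2)})=0$; $g(\eta)=\alpha$ if $\eta(e^{(1)})=\eta(e^{(2)})=1$ and $\eta(0)=\eta(e^{(1)}+e^{(2)})=0$; $g(\eta)=0$ otherwise. The Bernoulli product measure is $\nu_\rho(\eta)=\prod_{x\in\Lambda_N}\rho^{\eta(x)}(1-\rho)^{1-\eta(x)}$. Reversible means that the detailed balance condition holds.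
   Formalization: Non-reversibility for α≠0 is claimed only for 0<ρ<1, since at ρ=0 or 1 the measure is a point mass on an absorbing configuration and detailed balance holds trivially; N≥3 is assumed so that the faces f^±(x,y) and τ_f are well defined. *)

theory Defs
  imports Complex_Main "HOL-Library.Product_Plus" "Berlekamp_Zassenhaus.Finite_Field"
begin

section \<open>The discrete torus and its faces\<close>

text \<open>
  The side length is \<open>N = CARD('n)\<close>. A site is recorded by its integer coordinates modulo \<open>N\<close>,
  i.e. \<open>(a, b)\<close> stands for \<open>(a/N, b/N)\<close>; so \<open>e1\<close> and \<open>e2\<close> stand for \<open>(1/N, 0)\<close> and \<open>(0, 1/N)\<close>.
\<close>

type_synonym 'n site = "'n mod_ring \<times> 'n mod_ring"

definition e1 :: "'n::nontriv site" where
  "e1 = (1, 0)"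

definition e2 :: "'n::nontriv site" where
  "e2 = (0, 1)"

definition edges :: "('n::nontriv site \<times> 'n site) set" where
  "edges = {(x, y). \<exists>e\<in>{e1, e2}. y = x + e \<or> y = x - e}"

definition face :: "'n::nontriv site \<Rightarrow> 'n site set" where
  "face z = {z, z + e1, z + e1 + e2, z + e2}"

text \<open>The oriented edges traversed by the anticlockwise cycle around \<^term>\<open>face z\<close>;
  the clockwise cycle traverses their converses.\<close>

definition anticlockwise :: "'n::nontriv site \<Rightarrow> ('n site \<times> 'n site) set" where
  "anticlockwise z =
     {(z, z + e1), (z + e1, z + e1 + e2), (z + e1 + e2, z + e2), (z + e2, z)}"

definition clockwise :: "'n::nontriv site \<Rightarrow> ('n site \<times> 'n site) set" where
  "clockwise z = (anticlockwise z)\<inverse>"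

text \<open>The definite descriptions below are well defined for \<open>N \<ge> 3\<close>
  (lemmas \<open>face_inj\<close>, \<open>face_plus_unique\<close> and \<open>face_minus_unique\<close>), but not for \<open>N \<le> 2\<close>.\<close>

definition face_plus :: "'n::nontriv site \<Rightarrow> 'n site \<Rightarrow> 'n site set" where
  "face_plus x y = (THE F. \<exists>z. F = face z \<and> (x, y) \<in> anticlockwise z)"

definition face_minus :: "'n::nontriv site \<Rightarrow> 'n site \<Rightarrow> 'n site set" where
  "face_minus x y = (THE F. \<exists>z. F = face z \<and> (x, y) \<in> clockwise z)"

section \<open>Configurations and translations\<close>

text \<open>\<open>\<eta> x = True\<close> means occupation number 1.\<close>

type_synonym 'n config = "'n site \<Rightarrow> bool"

definition exch :: "'n::nontriv site \<Rightarrow> 'n site \<Rightarrow> 'n config \<Rightarrow> 'n config" where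
  "exch x y \<eta> = \<eta>(x := \<eta> y, y := \<eta> x)"

definition shift_config :: "'n::nontriv site \<Rightarrow> 'n config \<Rightarrow> 'n config" where
  "shift_config x \<eta> = (\<lambda>z. \<eta> (z - x))"

definition shift_fun :: "'n::nontriv site \<Rightarrow> ('n config \<Rightarrow> real) \<Rightarrow> 'n config \<Rightarrow> real" where
  "shift_fun x h = (\<lambda>\<eta>. h (shift_config (- x) \<eta>))"

definition shift_face :: "'n::nontriv site set \<Rightarrow> ('n config \<Rightarrow> real) \<Rightarrow> 'n config \<Rightarrow> real" where
  "shift_face F h = shift_fun (THE z. F = face z) h"

section \<open>Markov generators on a finite state space\<close>

text \<open>A generator acts on the real functions on the finite state space; its semigroup is
  \<open>exp (t L)\<close>, the exponential series converging absolutely for every linear \<open>L\<close>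
  (lemma \<open>summable_semigroup\<close>). Measures are given by their weights.\<close>

definition semigroup_of ::
  "(('s::finite \<Rightarrow> real) \<Rightarrow> 's \<Rightarrow> real) \<Rightarrow> real \<Rightarrow> ('s \<Rightarrow> real) \<Rightarrow> 's \<Rightarrow> real" where
  "semigroup_of L t f s = (\<Sum>k. t ^ k / fact k * (L ^^ k) f s)"

definition invariant :: "(('s::finite \<Rightarrow> real) \<Rightarrow> 's \<Rightarrow> real) \<Rightarrow> ('s \<Rightarrow> real) \<Rightarrow> bool" where
  "invariant L \<mu> \<longleftrightarrow>
     (\<forall>t\<ge>0. \<forall>f. (\<Sum>s\<in>UNIV. \<mu> s * semigroup_of L t f s) = (\<Sum>s\<in>UNIV. \<mu> s * f s))"

text \<open>The matrix entry of \<open>L\<close>; for \<open>s \<noteq> s'\<close> it is the rate of the jump from \<open>s\<close> to \<open>s'\<close>.\<close>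

definition rate :: "(('s::finite \<Rightarrow> real) \<Rightarrow> 's \<Rightarrow> real) \<Rightarrow> 's \<Rightarrow> 's \<Rightarrow> real" where
  "rate L s s' = L (\<lambda>u. of_bool (u = s')) s"

definition reversible :: "(('s::finite \<Rightarrow> real) \<Rightarrow> 's \<Rightarrow> real) \<Rightarrow> ('s \<Rightarrow> real) \<Rightarrow> bool" where
  "reversible L \<mu> \<longleftrightarrow> (\<forall>s s'. \<mu> s * rate L s s' = \<mu> s' * rate L s' s)"

section \<open>The exclusion process\<close>

definition g :: "real \<Rightarrow> 'n::nontriv config \<Rightarrow> real" where
  "g \<alpha> \<eta> =
     (if \<eta> 0 \<and> \<eta> (e1 + e2) \<and> \<not> \<eta> e1 \<and> \<not> \<eta> e2 then \<alpha>
      else if \<eta> e1 \<and> \<eta> e2 \<and> \<not> \<eta> 0 \<and> \<not> \<eta> (e1 + e2) then \<alpha>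
      else 0)"

definition c :: "real \<Rightarrow> 'n::nontriv site \<Rightarrow> 'n site \<Rightarrow> 'n config \<Rightarrow> real" where
  "c \<alpha> x y \<eta> =
     of_bool (\<eta> x) * (1 - of_bool (\<eta> y)) +
     of_bool (\<eta> x) * (shift_face (face_plus x y) (g \<alpha>) \<eta> - shift_face (face_minus x y) (g \<alpha>) \<eta>)"

definition gen :: "real \<Rightarrow> ('n::nontriv config \<Rightarrow> real) \<Rightarrow> 'n config \<Rightarrow> real" where
  "gen \<alpha> f \<eta> = (\<Sum>(x, y)\<in>edges. c \<alpha> x y \<eta> * (f (exch x y \<eta>) - f \<eta>))"

definition bernoulli :: "real \<Rightarrow> 'n::nontriv config \<Rightarrow> real" where
  "bernoulli \<rho> \<eta> = (\<Prod>x\<in>UNIV. \<rho> ^ of_bool (\<eta> x) * (1 - \<rho>) ^ (1 - of_bool (\<eta> x)))"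

section \<open>Well-definedness\<close>

lemma mod_ring_two_neq_zero:
  assumes "CARD('n::nontriv) \<ge> 3"
  shows "(1::'n mod_ring) + 1 \<noteq> 0"
proof -
  have "\<not> CARD('n) dvd 2" using assms by (auto dest: dvd_imp_le)
  then have "(of_nat 2 :: 'n mod_ring) \<noteq> 0"
    by (simp only: of_nat_eq_0_iff_char_dvd semiring_char_mod_ring) simp
  then show ?thesis by simp
qed

lemma face_inj:
  assumes "CARD('n::nontriv) \<ge> 3" and "face z = face (w :: 'n site)"
  shows "z = w"
proof -
  obtain a b a' b' where zw: "z = (a, b)" "w = (a', b')" by (cases z, cases w)
  have fst_eq: "{a, a + 1} = {a', a' + 1}"
    using arg_cong[OF assms(2), of "image fst"] by (simp add: face_def e1_def e2_def zw insert_commute)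
  have snd_eq: "{b, b + 1} = {b', b' + 1}"
    using arg_cong[OF assms(2), of "image snd"] by (simp add: face_def e1_def e2_def zw insert_commute)
  have "u = v" if "{u, u + 1} = {v, v + 1}" for u v :: "'n mod_ring"
    using that mod_ring_two_neq_zero[OF assms(1)]
    by (auto simp: doubleton_eq_iff add.assoc)
  with fst_eq snd_eq zw show ?thesis by blast
qed

lemma anticlockwise_iff:
  "(x, y) \<in> anticlockwise z \<longleftrightarrow>
     (y = x + e1 \<and> z = x) \<or> (y = x + e2 \<and> z = x - e1) \<or>
     (y = x - e1 \<and> z = x - e1 - e2) \<or> (y = x - e2 \<and> z = x - e2)"
  by (auto simp: anticlockwise_def algebra_simps)

lemma anticlockwise_unique:
  fixes x y :: "'n::nontriv site"
  assumes "CARD('n) \<ge> 3" and "(x, y) \<in> edges"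
  shows "\<exists>!z. (x, y) \<in> anticlockwise z"
proof -
  have "(1::'n mod_ring) \<noteq> - 1"
    using mod_ring_two_neq_zero[OF assms(1)] by (simp add: eq_neg_iff_add_eq_0)
  then show ?thesis
    using assms(2) unfolding anticlockwise_iff edges_def
    by (cases x; cases y) (auto simp: e1_def e2_def diff_conv_add_uminus simp del: add_uminus_conv_diff)
qed

lemma edges_sym: "(x, y) \<in> edges \<Longrightarrow> (y, x) \<in> edges"
  by (auto simp: edges_def)

lemma face_plus_unique:
  fixes x y :: "'n::nontriv site"
  assumes "CARD('n) \<ge> 3" and "(x, y) \<in> edges"
  shows "\<exists>!F. \<exists>z. F = face z \<and> (x, y) \<in> anticlockwise z"
  using anticlockwise_unique[OF assms] by metis

lemma face_minus_unique:
  fixes x y :: "'n::nontriv site"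
  assumes "CARD('n) \<ge> 3" and "(x, y) \<in> edges"
  shows "\<exists>!F. \<exists>z. F = face z \<and> (x, y) \<in> clockwise z"
  using anticlockwise_unique[OF assms(1) edges_sym[OF assms(2)]]
  unfolding clockwise_def converse_iff by metis

lemma shift_face_face:
  fixes z :: "'n::nontriv site"
  assumes "CARD('n) \<ge> 3"
  shows "shift_face (face z) h \<eta> = h (\<lambda>w. \<eta> (w + z))"
proof -
  have "(THE w. face z = face w) = z"
    using face_inj[OF assms] by (intro the_equality) auto
  then show ?thesis by (simp add: shift_face_def shift_fun_def shift_config_def)
qed

lemma face_plus_eq:
  fixes x y :: "'n::nontriv site"
  assumes "CARD('n) \<ge> 3" and "(x, y) \<in> edges" and "(x, y) \<in> anticlockwise z"
  shows "face_plus x y = face z"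
  unfolding face_plus_def by (rule the1_equality[OF face_plus_unique]) (use assms in blast)+

lemma face_minus_eq:
  fixes x y :: "'n::nontriv site"
  assumes "CARD('n) \<ge> 3" and "(x, y) \<in> edges" and "(x, y) \<in> clockwise z"
  shows "face_minus x y = face z"
  unfolding face_minus_def by (rule the1_equality[OF face_minus_unique]) (use assms in blast)+

lemma g_bound: "\<bar>g \<alpha> \<eta> - g \<alpha> \<zeta>\<bar> \<le> \<bar>\<alpha>\<bar>"
  by (simp add: g_def)

text \<open>Hence \<open>c\<close> is nonnegative even when both \<open>x\<close> and \<open>y\<close> are occupied.\<close>

lemma g_edge_eq_0:
  fixes x y :: "'n::nontriv site"
  assumes "(x, y) \<in> anticlockwise z \<or> (y, x) \<in> anticlockwise z" and "\<eta> x = \<eta> y"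
  shows "g \<alpha> (\<lambda>w. \<eta> (w + z)) = 0"
  using assms by (auto simp: anticlockwise_def g_def add.commute add.left_commute)

lemma c_nonneg:
  fixes x y :: "'n::nontriv site"
  assumes "CARD('n) \<ge> 3" and "(x, y) \<in> edges" and "\<bar>\<alpha>\<bar> < 1"
  shows "c \<alpha> x y \<eta> \<ge> 0"
proof -
  obtain z where z: "(x, y) \<in> anticlockwise z"
    using anticlockwise_unique[OF assms(1,2)] by blast
  obtain w where w: "(y, x) \<in> anticlockwise w"
    using anticlockwise_unique[OF assms(1) edges_sym[OF assms(2)]] by blast
  have "face_plus x y = face z" "face_minus x y = face w"
    using face_plus_eq[OF assms(1,2) z] face_minus_eq[OF assms(1,2)] w
    by (auto simp: clockwise_def)
  then have c: "c \<alpha> x y \<eta> = of_bool (\<eta> x) * (1 - of_bool (\<eta> y)) +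
      of_bool (\<eta> x) * (g \<alpha> (\<lambda>u. \<eta> (u + z)) - g \<alpha> (\<lambda>u. \<eta> (u + w)))"
    by (simp add: c_def shift_face_face[OF assms(1)])
  show ?thesis
  proof (cases "\<eta> x = \<eta> y")
    case True
    then have "g \<alpha> (\<lambda>u. \<eta> (u + z)) = 0" "g \<alpha> (\<lambda>u. \<eta> (u + w)) = 0"
      using z w by (auto intro: g_edge_eq_0)
    then show ?thesis by (simp add: c)
  next
    case False
    then show ?thesis
      using g_bound[of \<alpha> "\<lambda>u. \<eta> (u + z)" "\<lambda>u. \<eta> (u + w)"] assms(3) by (auto simp: c)
  qed
qed

lemma summable_semigroup:
  fixes L :: "('s::finite \<Rightarrow> real) \<Rightarrow> 's \<Rightarrow> real"
  assumes L: "\<And>f s. L f s = (\<Sum>u\<in>UNIV. K s u * f u)"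
  shows "summable (\<lambda>k. \<bar>t ^ k / fact k * (L ^^ k) f s\<bar>)"
proof -
  define M where "M = (\<Sum>s\<in>UNIV. \<Sum>u\<in>UNIV. \<bar>K s u\<bar>)"
  define B where "B = (\<Sum>u\<in>UNIV. \<bar>f u\<bar>)"
  have bound: "\<bar>(L ^^ k) f s\<bar> \<le> M ^ k * B" for k s
  proof (induction k arbitrary: s)
    case 0
    show ?case by (auto simp: B_def intro: member_le_sum)
  next
    case (Suc k)
    have MB: "M ^ k * B \<ge> 0" by (auto simp: M_def B_def intro!: mult_nonneg_nonneg zero_le_power sum_nonneg)
    have "\<bar>(L ^^ Suc k) f s\<bar> \<le> (\<Sum>u\<in>UNIV. \<bar>K s u\<bar> * \<bar>(L ^^ k) f u\<bar>)"
      by (simp add: L abs_mult[symmetric] sum_abs)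
    also have "\<dots> \<le> (\<Sum>u\<in>UNIV. \<bar>K s u\<bar> * (M ^ k * B))"
      by (intro sum_mono mult_left_mono Suc.IH) simp
    also have "\<dots> = (\<Sum>u\<in>UNIV. \<bar>K s u\<bar>) * (M ^ k * B)"
      by (simp add: sum_distrib_right)
    also have "\<dots> \<le> M * (M ^ k * B)"
      unfolding M_def
      by (intro mult_right_mono[OF _ MB[unfolded M_def]]
          member_le_sum[where f = "\<lambda>s. \<Sum>u\<in>UNIV. \<bar>K s u\<bar>"]) (auto intro: sum_nonneg)
    finally show ?case by simp
  qed
  have "summable (\<lambda>k. B * ((\<bar>t\<bar> * M) ^ k /\<^sub>R fact k))"
    by (intro summable_mult summable_exp_generic)
  then show ?thesis
  proof (rule summable_comparison_test'[where N = 0])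
    fix k
    have "\<bar>t ^ k / fact k * (L ^^ k) f s\<bar> = \<bar>t\<bar> ^ k / fact k * \<bar>(L ^^ k) f s\<bar>"
      by (simp add: abs_mult power_abs)
    also have "\<dots> \<le> \<bar>t\<bar> ^ k / fact k * (M ^ k * B)"
      by (intro mult_left_mono bound) simp
    also have "\<dots> = B * ((\<bar>t\<bar> * M) ^ k /\<^sub>R fact k)"
      by (simp add: power_mult_distrib field_simps)
    finally show "norm \<bar>t ^ k / fact k * (L ^^ k) f s\<bar> \<le> B * ((\<bar>t\<bar> * M) ^ k /\<^sub>R fact k)"
      by simp
  qed
qed

lemma gen_matrix: "gen \<alpha> f \<eta> = (\<Sum>u\<in>UNIV. rate (gen \<alpha>) \<eta> u * f u)"
proof -
  have pick: "(\<Sum>u\<in>UNIV. of_bool (v = u) * f u) = f v" for v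
    by (simp add: of_bool_def if_distrib[of "\<lambda>r. r * _"] cong: if_cong)
  have "gen \<alpha> f \<eta> = (\<Sum>p\<in>edges. \<Sum>u\<in>UNIV.
      c \<alpha> (fst p) (snd p) \<eta> * (of_bool (exch (fst p) (snd p) \<eta> = u) - of_bool (\<eta> = u)) * f u)"
    unfolding gen_def case_prod_unfold
    by (simp add: mult.assoc left_diff_distrib sum_subtractf pick flip: sum_distrib_left)
  also have "\<dots> = (\<Sum>u\<in>UNIV. rate (gen \<alpha>) \<eta> u * f u)"
    by (subst sum.swap) (simp add: rate_def gen_def case_prod_unfold sum_distrib_right)
  finally show ?thesis .
qed

end

theory Submission
  imports Defs
begin

text \<open>
  Each exchange preserves \<open>bernoulli \<rho>\<close>, so invariance amounts to
  \<open>\<Sum>(x, y)\<in>edges. c \<alpha> x y (exch x y \<eta>) = \<Sum>(x, y)\<in>edges. c \<alpha> x y \<eta>\<close>.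
  The symmetric parts agree on reversing edges. Because \<open>face_minus x y = face_plus y x\<close>, the
  asymmetric parts are sums over oriented edges \<open>(x, y)\<close> of a gradient times the value of
  \<open>g\<close> on \<open>face_plus x y\<close>; grouped by faces, they vanish: on the right the gradient telescopes around
  the cycle, and on the left an exchange along an edge of a face produces a checkerboard only from
  two adjacent particles, where exactly two edges do so, with opposite gradients.
  Detailed balance fails for two particles on the diagonal of a single face.
\<close>

section \<open>Exchanges\<close>

lemma exch_exch [simp]: "exch x y (exch x y \<eta>) = \<eta>"
  by (auto simp: exch_def)

lemma exch_commute: "exch x y = exch y x"
proof (rule ext)
  show "exch x y \<eta> = exch y x \<eta>" for \<eta>
    unfolding exch_def by (cases "x = y") (simp, rule fun_upd_twist)
qed

text \<open>The sites where \<open>exch x y \<eta>\<close> differs from \<open>\<eta>\<close> are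
  exactly \<open>x\<close> and \<open>y\<close>, and an exchange can change only its own endpoints.
  This identifies the edges contributing to a jump rate.\<close>

lemma exch_eq_iff:
  assumes "\<eta> x \<noteq> \<eta> y"
  shows "exch u v \<eta> = exch x y \<eta> \<longleftrightarrow> (u = x \<and> v = y) \<or> (u = y \<and> v = x)"
proof
  assume eq: "exch u v \<eta> = exch x y \<eta>"
  have fixed: "exch u v \<eta> w = \<eta> w" if "\<not> (w = u \<or> w = v)" for w
    using that by (simp add: exch_def)
  have "x \<noteq> y" using assms by auto
  then have "exch u v \<eta> x \<noteq> \<eta> x" "exch u v \<eta> y \<noteq> \<eta> y"
    using assms by (simp_all add: eq) (simp_all add: exch_def)
  then have "x = u \<or> x = v" "y = u \<or> y = v"
    using fixed by blast+
  with \<open>x \<noteq> y\<close> show "(u = x \<and> v = y) \<or> (u = y \<and> v = x)"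
    by blast
next
  assume "(u = x \<and> v = y) \<or> (u = y \<and> v = x)"
  then show "exch u v \<eta> = exch x y \<eta>"
    using exch_commute[of x y] by (elim disjE conjE) simp_all
qed

lemma bernoulli_exch: "bernoulli \<rho> (exch x y \<eta>) = bernoulli \<rho> \<eta>"
proof -
  let ?w = "\<lambda>b. \<rho> ^ of_bool b * (1 - \<rho>) ^ (1 - of_bool b)"
  \<comment> \<open>The transposition of \<open>x\<close> and \<open>y\<close>: an exchange only
    permutes the factors of the product.\<close>
  define t where "t = (\<lambda>u. if u = x then y else if u = y then x else u)"
  have "t (t u) = u" for u by (simp add: t_def)
  then have "bij t" by (rule involuntory_imp_bij)
  have "exch x y \<eta> u = \<eta> (t u)" for u by (simp add: exch_def t_def)
  then have "bernoulli \<rho> (exch x y \<eta>) = (\<Prod>u\<in>UNIV. ?w (\<eta> (t u)))"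
    by (simp add: bernoulli_def)
  also have "\<dots> = bernoulli \<rho> \<eta>"
    unfolding bernoulli_def by (rule prod.reindex_bij_betw[OF \<open>bij t\<close>])
  finally show ?thesis .
qed

lemma bernoulli_pos: "0 < \<rho> \<Longrightarrow> \<rho> < 1 \<Longrightarrow> bernoulli \<rho> \<eta> > 0"
  unfolding bernoulli_def by (intro prod_pos mult_pos_pos zero_less_power) simp_all

lemma sum_exch: "(\<Sum>\<eta>\<in>UNIV. h (exch x y \<eta>)) = (\<Sum>\<eta>\<in>UNIV. h \<eta>)"
  by (rule sum.reindex_bij_betw[OF involuntory_imp_bij[OF exch_exch]])

section \<open>Sums over oriented edges\<close>

lemma sum_edges_swap: "(\<Sum>(x, y)\<in>edges. h y x) = (\<Sum>(x, y)\<in>edges. h x y)"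
  by (rule sum.reindex_bij_witness[where i = prod.swap and j = prod.swap])
    (auto intro: edges_sym)

lemma edges_eq_Union_anticlockwise: "edges = (\<Union>z. anticlockwise z)"
  by (auto simp: edges_def anticlockwise_iff)

lemma face_corners_distinct:
  fixes z :: "'n::nontriv site"
  shows "distinct [z, z + e1, z + e1 + e2, z + e2]"
  by (cases z) (auto simp: e1_def e2_def)

text \<open>The anticlockwise cycles partition the oriented edges: every edge lies on some cycle,
  and for side length at least 3 on only one.\<close>

lemma sum_edges_faces:
  fixes h :: "'n::nontriv site \<Rightarrow> 'n site \<Rightarrow> 'b::comm_monoid_add"
  assumes "CARD('n) \<ge> 3"
  shows "(\<Sum>(x, y)\<in>edges. h x y) = (\<Sum>z\<in>UNIV.
    h z (z + e1) + h (z + e1) (z + e1 + e2) + h (z + e1 + e2) (z + e2) + h (z + e2) z)"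
proof -
  have "(\<Sum>(x, y)\<in>edges. h x y) = (\<Sum>z\<in>UNIV. \<Sum>(x, y)\<in>anticlockwise z. h x y)"
    unfolding edges_eq_Union_anticlockwise
  proof (rule sum.UNION_disjoint)
    show "\<forall>z\<in>UNIV. finite (anticlockwise z)" by (simp add: anticlockwise_def)
    show "\<forall>z\<in>UNIV. \<forall>w\<in>UNIV. z \<noteq> w \<longrightarrow> anticlockwise z \<inter> anticlockwise (w :: 'n site) = {}"
      using anticlockwise_unique[OF assms] unfolding edges_eq_Union_anticlockwise by fast
  qed simp
  also have "\<dots> = (\<Sum>z\<in>UNIV.
      h z (z + e1) + h (z + e1) (z + e1 + e2) + h (z + e1 + e2) (z + e2) + h (z + e2) z)"
  proof (rule sum.cong[OF refl])
    fix z :: "'n site"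
    show "(\<Sum>(x, y)\<in>anticlockwise z. h x y) =
      h z (z + e1) + h (z + e1) (z + e1 + e2) + h (z + e1 + e2) (z + e2) + h (z + e2) z"
      using face_corners_distinct[of z] unfolding anticlockwise_def
      by (auto simp: add.assoc)
  qed
  finally show ?thesis .
qed

section \<open>Invariance\<close>

text \<open>The value of \<open>g\<close> on the face to the left of the oriented edge; the face to
  the right is then reached by reversing the edge.\<close>

definition face_rate :: "real \<Rightarrow> 'n::nontriv site \<Rightarrow> 'n site \<Rightarrow> 'n config \<Rightarrow> real" where
  "face_rate \<alpha> x y \<eta> = shift_face (face_plus x y) (g \<alpha>) \<eta>"

lemma face_minus_eq_face_plus: "face_minus x y = face_plus y x"
  by (simp add: face_minus_def face_plus_def clockwise_def)

lemma c_eq_face_rate: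
  "c \<alpha> x y \<eta> = of_bool (\<eta> x) * (1 - of_bool (\<eta> y)) +
     of_bool (\<eta> x) * (face_rate \<alpha> x y \<eta> - face_rate \<alpha> y x \<eta>)"
  by (simp add: c_def face_rate_def face_minus_eq_face_plus)

lemma face_rate_eq:
  fixes x y z :: "'n::nontriv site"
  assumes "CARD('n) \<ge> 3" and "(x, y) \<in> anticlockwise z"
  shows "face_rate \<alpha> x y \<eta> = g \<alpha> (\<lambda>w. \<eta> (w + z))"
proof -
  have "(x, y) \<in> edges" using assms(2) unfolding edges_eq_Union_anticlockwise by blast
  then show ?thesis
    by (simp add: face_rate_def face_plus_eq[OF assms(1) _ assms(2)] shift_face_face[OF assms(1)])
qed

text \<open>The two patterns in \<open>g\<close> are the two checkerboards on a face: each diagonal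
  is constant and the diagonals differ.\<close>

lemma g_shift:
  "g \<alpha> (\<lambda>w. \<eta> (w + z)) =
    (if \<eta> z = \<eta> (z + e1 + e2) \<and> \<eta> (z + e1) = \<eta> (z + e2) \<and> \<eta> z \<noteq> \<eta> (z + e1) then \<alpha> else 0)"
  by (simp add: g_def add.commute[of _ z] add.assoc) blast

lemma sum_c:
  fixes \<eta> :: "'n::nontriv config"
  assumes "CARD('n) \<ge> 3"
  shows "(\<Sum>(x, y)\<in>edges. c \<alpha> x y \<eta>) = (\<Sum>(x, y)\<in>edges. of_bool (\<eta> x) * (1 - of_bool (\<eta> y)))"
proof -
  \<comment> \<open>Reversing the edges in the subtracted sum turns the difference of face values
    into a gradient of \<open>\<eta>\<close>.\<close>
  have "(\<Sum>(x, y)\<in>edges. of_bool (\<eta> x) * (face_rate \<alpha> x y \<eta> - face_rate \<alpha> y x \<eta>)) =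
      (\<Sum>(x, y)\<in>edges. (of_bool (\<eta> x) - of_bool (\<eta> y)) * face_rate \<alpha> x y \<eta>)"
    using sum_edges_swap[of "\<lambda>x y. of_bool (\<eta> y) * face_rate \<alpha> x y \<eta>"]
    by (simp add: case_prod_unfold algebra_simps sum_subtractf)
  also have "\<dots> = 0"
    unfolding sum_edges_faces[OF assms]
  proof (intro sum.neutral ballI)
    fix z :: "'n site"
    \<comment> \<open>Here \<open>k\<close> is the value of \<open>g\<close> on the face, common to
      its four edges.\<close>
    have telescope: "(p - q) * k + (q - r) * k + (r - s) * k + (s - p) * k = 0" for p q r s k :: real
      by (simp add: left_diff_distrib)
    let ?G = "\<lambda>x y. (of_bool (\<eta> x) - of_bool (\<eta> y)) * face_rate \<alpha> x y \<eta>"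
    have F: "face_rate \<alpha> x y \<eta> = g \<alpha> (\<lambda>w. \<eta> (w + z))" if "(x, y) \<in> anticlockwise z" for x y
      by (rule face_rate_eq[OF assms that])
    show "?G z (z + e1) + ?G (z + e1) (z + e1 + e2) + ?G (z + e1 + e2) (z + e2) + ?G (z + e2) z = 0"
      by (simp only: F anticlockwise_def insertI1 insertI2 telescope)
  qed
  finally show ?thesis
    by (simp add: c_eq_face_rate case_prod_unfold sum.distrib)
qed

text \<open>The corners are in cyclic order. For an adjacent pair of particles, the two edges
  joining it to the holes produce a checkerboard; the cycle enters the pair along one and leaves it
  along the other, so the terms are \<open>\<alpha>\<close> and \<open>- \<alpha>\<close>. No other
  occupation gives a nonzero term.\<close>

lemma checkerboard_exch_cancel:
  fixes \<alpha> :: real and p q r s :: "'n::nontriv site"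
    and \<eta> :: "'n config"
  assumes "distinct [p, q, r, s]"
  defines "G \<equiv> \<lambda>x y. (of_bool (\<eta> y) - of_bool (\<eta> x)) *
    (let \<zeta> = exch x y \<eta> in if \<zeta> p = \<zeta> r \<and> \<zeta> q = \<zeta> s \<and> \<zeta> p \<noteq> \<zeta> q then \<alpha> else 0)"
  shows "G p q + G q r + G r s + G s p = 0"
proof -
  have ne: "p \<noteq> q" "p \<noteq> r" "p \<noteq> s" "q \<noteq> r" "q \<noteq> s" "r \<noteq> s"
    using assms(1) by simp_all
  show ?thesis
    by (cases "\<eta> p"; cases "\<eta> q"; cases "\<eta> r"; cases "\<eta> s")
      (simp_all add: G_def exch_def ne ne[symmetric])
qed

lemma sum_c_exch:
  fixes \<eta> :: "'n::nontriv config"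
  assumes "CARD('n) \<ge> 3"
  shows "(\<Sum>(x, y)\<in>edges. c \<alpha> x y (exch x y \<eta>)) =
    (\<Sum>(x, y)\<in>edges. of_bool (\<eta> x) * (1 - of_bool (\<eta> y)))"
proof -
  have [simp]: "exch x y \<eta> x = \<eta> y" "exch x y \<eta> y = \<eta> x" for x y
    by (auto simp: exch_def)
  let ?F = "\<lambda>x y. face_rate \<alpha> x y (exch x y \<eta>)"
  have "(\<Sum>(x, y)\<in>edges. of_bool (\<eta> y) * (?F x y - ?F y x)) =
      (\<Sum>(x, y)\<in>edges. (of_bool (\<eta> y) - of_bool (\<eta> x)) * ?F x y)"
    using sum_edges_swap[of "\<lambda>x y. of_bool (\<eta> x) * ?F x y"]
    by (simp add: case_prod_unfold algebra_simps sum_subtractf)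
  also have "\<dots> = 0"
    unfolding sum_edges_faces[OF assms]
  proof (intro sum.neutral ballI)
    fix z :: "'n site"
    let ?G = "\<lambda>x y. (of_bool (\<eta> y) - of_bool (\<eta> x)) * ?F x y"
    have F: "?F x y = g \<alpha> (\<lambda>w. exch x y \<eta> (w + z))" if "(x, y) \<in> anticlockwise z" for x y
      by (rule face_rate_eq[OF assms that])
    show "?G z (z + e1) + ?G (z + e1) (z + e1 + e2) + ?G (z + e1 + e2) (z + e2) + ?G (z + e2) z = 0"
      using checkerboard_exch_cancel[OF face_corners_distinct, of \<eta> z \<alpha>, unfolded Let_def]
      by (simp only: F anticlockwise_def g_shift insertI1 insertI2)
  qed
  finally have asym: "(\<Sum>(x, y)\<in>edges. of_bool (\<eta> y) * (?F x y - ?F y x)) = 0" .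
  \<comment> \<open>\<open>?F y x\<close> is evaluated at \<open>exch y x \<eta>\<close>, which is
    the same configuration as \<open>exch x y \<eta>\<close>.\<close>
  have "(\<Sum>(x, y)\<in>edges. c \<alpha> x y (exch x y \<eta>)) =
      (\<Sum>(x, y)\<in>edges. of_bool (\<eta> y) * (1 - of_bool (\<eta> x)) + of_bool (\<eta> y) * (?F x y - ?F y x))"
    by (intro sum.cong) (auto simp: c_eq_face_rate exch_commute)
  also have "\<dots> = (\<Sum>(x, y)\<in>edges. of_bool (\<eta> y) * (1 - of_bool (\<eta> x)))"
    using asym by (simp add: case_prod_unfold sum.distrib)
  also have "\<dots> = (\<Sum>(x, y)\<in>edges. of_bool (\<eta> x) * (1 - of_bool (\<eta> y)))"
    by (rule sum_edges_swap)
  finally show ?thesis .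
qed

text \<open>Substituting \<open>exch x y \<eta>\<close> for \<open>\<eta>\<close> in the gain term
  makes the coefficient of \<open>f \<eta>\<close> total inflow minus total outflow; both equal the
  number of oriented edges from a particle to a hole.\<close>

lemma sum_bernoulli_gen:
  fixes f :: "'n::nontriv config \<Rightarrow> real"
  assumes "CARD('n) \<ge> 3"
  shows "(\<Sum>\<eta>\<in>UNIV. bernoulli \<rho> \<eta> * gen \<alpha> f \<eta>) = 0"
proof -
  have swap: "(\<Sum>\<eta>\<in>UNIV. bernoulli \<rho> \<eta> * (c \<alpha> x y \<eta> * f (exch x y \<eta>))) =
      (\<Sum>\<eta>\<in>UNIV. bernoulli \<rho> \<eta> * (c \<alpha> x y (exch x y \<eta>) * f \<eta>))" for x y
    using sum_exch[of "\<lambda>\<eta>. bernoulli \<rho> \<eta> * (c \<alpha> x y (exch x y \<eta>) * f \<eta>)" x y]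
    by (simp add: bernoulli_exch)
  have "(\<Sum>\<eta>\<in>UNIV. bernoulli \<rho> \<eta> * gen \<alpha> f \<eta>) =
      (\<Sum>(x, y)\<in>edges. \<Sum>\<eta>\<in>UNIV. bernoulli \<rho> \<eta> * (c \<alpha> x y \<eta> * f (exch x y \<eta>))
         - bernoulli \<rho> \<eta> * (c \<alpha> x y \<eta> * f \<eta>))"
    unfolding gen_def sum_distrib_left case_prod_unfold
    by (subst sum.swap) (simp add: algebra_simps)
  also have "\<dots> = (\<Sum>(x, y)\<in>edges. \<Sum>\<eta>\<in>UNIV.
      bernoulli \<rho> \<eta> * f \<eta> * (c \<alpha> x y (exch x y \<eta>) - c \<alpha> x y \<eta>))"
    by (simp add: sum_subtractf swap) (simp add: algebra_simps flip: sum_subtractf)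
  also have "\<dots> = (\<Sum>\<eta>\<in>UNIV. bernoulli \<rho> \<eta> * f \<eta> *
      ((\<Sum>(x, y)\<in>edges. c \<alpha> x y (exch x y \<eta>)) - (\<Sum>(x, y)\<in>edges. c \<alpha> x y \<eta>)))"
    unfolding case_prod_unfold
    by (subst sum.swap) (simp add: sum_distrib_left sum_subtractf algebra_simps)
  also have "\<dots> = 0"
    by (simp add: sum_c[OF assms] sum_c_exch[OF assms])
  finally show ?thesis .
qed

text \<open>Integrating the exponential series term by term, every term with
  \<open>k \<noteq> 0\<close> is an integral of \<open>L\<close> applied to some function and
  vanishes. The matrix form of \<open>L\<close> ensures convergence.\<close>

lemma invariantI:
  fixes L :: "('s::finite \<Rightarrow> real) \<Rightarrow> 's \<Rightarrow> real"
  assumes L: "\<And>f s. L f s = (\<Sum>u\<in>UNIV. K s u * f u)"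
    and zero: "\<And>f. (\<Sum>s\<in>UNIV. \<mu> s * L f s) = 0"
  shows "invariant L \<mu>"
  unfolding invariant_def
proof (intro allI impI)
  fix t :: real and f
  have "(\<lambda>k. t ^ k / fact k * (L ^^ k) f s) sums semigroup_of L t f s" for s
    unfolding semigroup_of_def
    by (rule summable_sums[OF summable_rabs_cancel[OF summable_semigroup[OF L]]])
  then have "(\<lambda>k. \<Sum>s\<in>UNIV. \<mu> s * (t ^ k / fact k * (L ^^ k) f s)) sums
      (\<Sum>s\<in>UNIV. \<mu> s * semigroup_of L t f s)"
    by (intro sums_sum sums_mult)
  moreover have "(\<lambda>k. \<Sum>s\<in>UNIV. \<mu> s * (t ^ k / fact k * (L ^^ k) f s)) sums
      (\<Sum>s\<in>UNIV. \<mu> s * f s)"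
  proof -
    have "(\<Sum>s\<in>UNIV. \<mu> s * (t ^ k / fact k * (L ^^ k) f s)) = 0" if k: "k \<noteq> 0" for k
    proof -
      obtain j where "k = Suc j" using k not0_implies_Suc by blast
      moreover have "(\<Sum>s\<in>UNIV. \<mu> s * (t ^ k / fact k * (L ^^ k) f s)) =
          t ^ k / fact k * (\<Sum>s\<in>UNIV. \<mu> s * (L ^^ k) f s)"
        by (simp only: sum_distrib_left mult.left_commute)
      ultimately show ?thesis using zero[of "(L ^^ j) f"] by simp
    qed
    then show ?thesis
      using sums_finite[of "{0}" "\<lambda>k. \<Sum>s\<in>UNIV. \<mu> s * (t ^ k / fact k * (L ^^ k) f s)"] by simp
  qed
  ultimately show "(\<Sum>s\<in>UNIV. \<mu> s * semigroup_of L t f s) = (\<Sum>s\<in>UNIV. \<mu> s * f s)"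
    by (rule sums_unique2)
qed

section \<open>Detailed balance\<close>

text \<open>Only \<open>(x, y)\<close> and \<open>(y, x)\<close> lead to this configuration, and the
  latter has rate 0 because \<open>y\<close> is empty.\<close>

lemma rate_gen_exch:
  assumes "(x, y) \<in> edges" and "\<eta> x" and "\<not> \<eta> y"
  shows "rate (gen \<alpha>) \<eta> (exch x y \<eta>) = c \<alpha> x y \<eta>"
proof -
  have "x \<noteq> y" using assms by metis
  then have "exch x y \<eta> x \<noteq> \<eta> x"
    using assms by (simp add: exch_def)
  then have ne: "\<eta> \<noteq> exch x y \<eta>" by metis
  have "rate (gen \<alpha>) \<eta> (exch x y \<eta>) =
      (\<Sum>(u, v)\<in>edges. c \<alpha> u v \<eta> * of_bool (exch u v \<eta> = exch x y \<eta>))"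
    using ne by (simp add: rate_def gen_def)
  also have "\<dots> = (\<Sum>(u, v)\<in>{(x, y)}. c \<alpha> u v \<eta> * of_bool (exch u v \<eta> = exch x y \<eta>))"
  proof (intro sum.mono_neutral_right ballI)
    fix p assume p: "p \<in> edges - {(x, y)}"
    have "c \<alpha> y x \<eta> = 0" using assms by (simp add: c_def)
    moreover obtain u v where uv: "p = (u, v)" by (cases p)
    moreover have "u = y \<and> v = x" if "exch u v \<eta> = exch x y \<eta>"
      using that p uv assms exch_eq_iff[of \<eta> x y u v] by blast
    ultimately show "(case p of (u, v) \<Rightarrow> c \<alpha> u v \<eta> * of_bool (exch u v \<eta> = exch x y \<eta>)) = 0"
      by (cases "exch u v \<eta> = exch x y \<eta>") auto
  qed (use assms in auto)
  finally show ?thesis by simp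
qed

text \<open>With \<open>g\<close> zero, each jump along \<open>(x, y)\<close> is matched by the
  return jump along \<open>(y, x)\<close>, with equal rate and equal weight.\<close>

lemma reversible_gen_0: "reversible (gen 0) (bernoulli \<rho> :: 'n::nontriv config \<Rightarrow> real)"
  unfolding reversible_def
proof (intro allI)
  fix s s' :: "'n config"
  have [simp]: "g 0 = (\<lambda>\<eta> :: 'n config. 0)" by (auto simp: g_def)
  have c0: "c 0 x y \<eta> = of_bool (\<eta> x) * (1 - of_bool (\<eta> y))" for x y and \<eta> :: "'n config"
    by (simp add: c_def shift_face_def shift_fun_def)
  show "bernoulli \<rho> s * rate (gen 0) s s' = bernoulli \<rho> s' * rate (gen 0) s' s"
  proof (cases "s = s'")
    case False
    \<comment> \<open>Off the diagonal the loss term of the generator drops out.\<close>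
    then have rate: "rate (gen 0) u v = (\<Sum>(x, y)\<in>edges. c 0 x y u * of_bool (exch x y u = v))"
      if "{u, v} = {s, s'}" for u v
      using that by (auto simp: rate_def gen_def doubleton_eq_iff)
    have "bernoulli \<rho> s * (c 0 x y s * of_bool (exch x y s = s')) =
        bernoulli \<rho> s' * (c 0 y x s' * of_bool (exch y x s' = s))" for x y
    proof (cases "exch x y s = s'")
      case True
      then have "exch y x s' = s" by (auto simp: exch_commute[of y x])
      moreover have "bernoulli \<rho> s' = bernoulli \<rho> s"
        using True bernoulli_exch by metis
      moreover have "c 0 x y s = c 0 y x s'"
        unfolding c0 True[symmetric] by (auto simp: exch_def)
      ultimately show ?thesis using True by simp
    next
      case False
      then have "exch y x s' \<noteq> s" by (auto simp: exch_commute[of y x])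
      with False show ?thesis by simp
    qed
    then have "bernoulli \<rho> s * rate (gen 0) s s' =
        (\<Sum>(x, y)\<in>edges. bernoulli \<rho> s' * (c 0 y x s' * of_bool (exch y x s' = s)))"
      by (simp only: rate sum_distrib_left case_prod_unfold)
    also have "\<dots> = (\<Sum>(x, y)\<in>edges. bernoulli \<rho> s' * (c 0 x y s' * of_bool (exch x y s' = s)))"
      by (rule sum_edges_swap)
    also have "\<dots> = bernoulli \<rho> s' * rate (gen 0) s' s"
      by (simp only: rate[OF insert_commute] sum_distrib_left case_prod_unfold)
    finally show ?thesis .
  qed simp
qed

text \<open>The jump from \<open>s\<close> to \<open>s'\<close> has rate
  \<open>1 + \<alpha>\<close>, the return jump rate 1. At density 0 or 1 the measure is a point mass
  on a frozen configuration, where detailed balance holds trivially.\<close>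

lemma not_reversible_gen:
  assumes N: "CARD('n::nontriv) \<ge> 3" and "\<alpha> \<noteq> 0" and "0 < \<rho>" and "\<rho> < 1"
  shows "\<not> reversible (gen \<alpha>) (bernoulli \<rho> :: 'n config \<Rightarrow> real)"
proof
  assume rev: "reversible (gen \<alpha>) (bernoulli \<rho> :: 'n config \<Rightarrow> real)"
  define s :: "'n config" where "s = (\<lambda>w. w = 0 \<or> w = e1 + e2)"
  define s' where "s' = exch 0 e1 s"
  \<comment> \<open>This separates \<open>e1 - e2\<close> from \<open>e1 + e2\<close>, so the lower
    two corners of the face below the edge are empty.\<close>
  have one: "(1 :: 'n mod_ring) \<noteq> - 1"
    using mod_ring_two_neq_zero[OF N] by (simp add: eq_neg_iff_add_eq_0)
  have s: "s 0" "\<not> s e1" "s (e1 + e2)" "\<not> s e2" "\<not> s (- e2)" "\<not> s (e1 - e2)"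
    using one one[symmetric] by (auto simp: s_def e1_def e2_def zero_prod_def)
  have s': "\<not> s' 0" "s' e1" "s' (e1 + e2)" "\<not> s' e2" "\<not> s' (- e2)" "\<not> s' (e1 - e2)"
    using s by (auto simp: s'_def exch_def e1_def e2_def zero_prod_def)
  have edge: "(0, e1) \<in> edges" "(e1, 0) \<in> edges"
    by (auto simp: edges_def)
  \<comment> \<open>The faces above and below the edge; only the upper one, and only in
    \<open>s\<close>, is a checkerboard.\<close>
  have "(0, e1) \<in> anticlockwise (0 :: 'n site)" "(e1, 0) \<in> anticlockwise (- e2 :: 'n site)"
    by (simp_all add: anticlockwise_iff)
  note face = this[THEN face_rate_eq[OF N], of \<alpha>, unfolded g_shift]
  have rates: "face_rate \<alpha> 0 e1 s = \<alpha> \<and> face_rate \<alpha> 0 e1 s' = 0 \<and>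
      face_rate \<alpha> e1 0 s = 0 \<and> face_rate \<alpha> e1 0 s' = 0"
    using s s' by (simp_all add: face)
  have "bernoulli \<rho> s * rate (gen \<alpha>) s s' = bernoulli \<rho> s' * rate (gen \<alpha>) s' s"
    using rev by (simp add: reversible_def)
  moreover have "bernoulli \<rho> s' = bernoulli \<rho> s"
    by (simp add: s'_def bernoulli_exch)
  ultimately have "rate (gen \<alpha>) s s' = rate (gen \<alpha>) s' s"
    using bernoulli_pos[OF assms(3,4), of s] by simp
  moreover have "rate (gen \<alpha>) s s' = c \<alpha> 0 e1 s"
    unfolding s'_def by (rule rate_gen_exch) (use edge s in auto)
  moreover have "rate (gen \<alpha>) s' s = c \<alpha> e1 0 s'"
    using rate_gen_exch[of e1 0 s' \<alpha>] edge s' by (simp add: s'_def exch_commute[of e1 0])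
  ultimately show False
    using s s' rates \<open>\<alpha> \<noteq> 0\<close> by (simp add: c_eq_face_rate)
qed

theorem lemma2p1:
  fixes \<alpha> \<rho> :: real
  assumes "CARD('n::nontriv) \<ge> 3" and "\<bar>\<alpha>\<bar> < 1" and "0 \<le> \<rho>" and "\<rho> \<le> 1"
  shows "invariant (gen \<alpha>) (bernoulli \<rho> :: 'n config \<Rightarrow> real) \<and>
    (\<alpha> \<noteq> 0 \<and> 0 < \<rho> \<and> \<rho> < 1 \<longrightarrow> \<not> reversible (gen \<alpha>) (bernoulli \<rho> :: 'n config \<Rightarrow> real)) \<and>
    (\<alpha> = 0 \<longrightarrow> reversible (gen \<alpha>) (bernoulli \<rho> :: 'n config \<Rightarrow> real))"
proof (intro conjI impI)
  show "invariant (gen \<alpha>) (bernoulli \<rho> :: 'n config \<Rightarrow> real)"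
    by (rule invariantI[OF gen_matrix sum_bernoulli_gen[OF assms(1)]])
  show "\<not> reversible (gen \<alpha>) (bernoulli \<rho> :: 'n config \<Rightarrow> real)" if "\<alpha> \<noteq> 0 \<and> 0 < \<rho> \<and> \<rho> < 1"
    using that not_reversible_gen[OF assms(1)] by blast
  show "reversible (gen \<alpha>) (bernoulli \<rho> :: 'n config \<Rightarrow> real)" if "\<alpha> = 0"
    using that reversible_gen_0 by simp
qed

end
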